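(* Let $(\mathcal S',\mathcal A',\lambda')$ and $(\mathcal S,\mathcal A,\lambda)$ be disjoint $\sigma$-finite measure spaces, let $\pi$ be a probability measure on their mixture space $\mathcal S\cup\mathcal S'$ with density $p$ w.r.t. the mixture measure of $\lambda$ and $\lambda'$, and let $X\sim\pi$. Let $\mathbf s:\mathcal S'\to\mathcal S$ be measurable and define $g:\mathcal S\cup\mathcal S'\to\mathcal S$ by $g(x)=\mathbf s(x)$ for $x\in\mathcal S'$ and $g(x)=x$ for $x\in\mathcal S$. Assume that there exist a $\sigma$-finite measure space $(\mathcal U,\mathcal B,\nu)$ and measurable functions $\mathbf u:\mathcal S'\to\mathcal U$ and $f:\mathcal S\times\mathcal U\to\mathbb R_{\ge0}$ such that (I) $(\mathbf s,\mathbf u):\mathcal S'\to\mathcal S\times\mathcal U$ is a bijection; (II) $\lambda'\big((\mathbf s,\mathbf u)^{-1}(ds,du)\big)=f(s,u)\,\lambda\otimes\nu(ds,du)$, i.e. $\lambda'\big((\mathbf s,\mathbf u)^{-1}(C)\big)=\int_C f\,d(\lambda\otimes\nu)$ for all $C\in\mathcal A\otimes\mathcal B$. Then for $s\in\mathcal S$ the conditional distribution of $X$ given $g(X)=s$ may be written as $$\mathbb P(X\in\cdot\mid g(X)=s)\ \propto\ p(s)\,\delta_s(\cdot)+\int\delta_{(\mathbf s,\mathbf u)^{-1}(s,u)}(\cdot)\;p\big((\mathbf s,\mathbf u)^{-1}(s,u)\big)\,f(s,u)\,\nu(du),$$ where the proportionality constant may depend on $s$.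
   Context: Mixture space of $(\mathcal S,\mathcal A,\lambda)$ and $(\mathcal S',\mathcal A',\lambda')$: the disjoint union $\mathcal S\cup\mathcal S'$ with the $\sigma$-algebra generated by $\mathcal A\cup\mathcal A'$ and the measure which is the sum of the images of $\lambda$ and $\lambda'$ under the inclusions. The conclusion means: the right-hand side, normalised to a probability measure in its argument "$\cdot$", is a version of the conditional distribution of $X$ given $g(X)=s$, i.e. writing $Q(s,\cdot)$ for it, $\int_B Q(s,A)\,\pi\circ g^{-1}(ds)=\pi(A\cap g^{-1}(B))$ for all $B\in\mathcal A$ and all measurable $A\subseteq\mathcal S\cup\mathcal S'$.
   Formalization: The formal theorem additionally assumes that the inverse of the bijection (s,u) is measurable from S×U to S'; without this the integral over u on the right-hand side need not be defined (e.g. when the σ-algebra of S' is enlarged by a non-measurable set). *)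

theory Defs
  imports "HOL-Probability.Probability"
begin

text \<open>The disjoint union is rendered literally: both spaces live in one type and their carriers are
  disjoint (a hypothesis of the theorem, not part of this definition).\<close>

definition mixture_algebra :: "'a measure \<Rightarrow> 'a measure \<Rightarrow> 'a measure" where
  "mixture_algebra M M' = sigma (space M \<union> space M') (sets M \<union> sets M')"

definition mixture_measure :: "'a measure \<Rightarrow> 'a measure \<Rightarrow> 'a measure" where
  "mixture_measure M M' =
     measure_of (space M \<union> space M') (sets M \<union> sets M')
       (\<lambda>A. emeasure (distr M (mixture_algebra M M') (\<lambda>x. x)) A
          + emeasure (distr M' (mixture_algebra M M') (\<lambda>x. x)) A)"

text \<open>\<open>K\<close> is a version of the (regular) conditional distribution, under the probability measure \<open>\<Omega>\<close>,
  of the \<open>N\<close>-valued variable \<open>X\<close> given the \<open>M\<close>-valued variable \<open>Y\<close>. Measurability into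
  \<open>prob_algebra N\<close> says that \<open>K\<close> is a Markov kernel.\<close>

definition cond_distribution ::
  "'w measure \<Rightarrow> 'a measure \<Rightarrow> ('w \<Rightarrow> 'a) \<Rightarrow> 'b measure \<Rightarrow> ('w \<Rightarrow> 'b) \<Rightarrow> ('b \<Rightarrow> 'a measure) \<Rightarrow> bool"
where
  "cond_distribution \<Omega> N X M Y K \<longleftrightarrow>
     X \<in> \<Omega> \<rightarrow>\<^sub>M N \<and> Y \<in> \<Omega> \<rightarrow>\<^sub>M M \<and> K \<in> M \<rightarrow>\<^sub>M prob_algebra N \<and>
     (\<forall>A\<in>sets N. \<forall>B\<in>sets M.
        (\<integral>\<^sup>+ y\<in>B. emeasure (K y) A \<partial>distr \<Omega> M Y) =
        emeasure \<Omega> {\<omega> \<in> space \<Omega>. X \<omega> \<in> A \<and> Y \<omega> \<in> B})"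

text \<open>A measure can be normalised only if its total mass is neither \<open>0\<close> nor \<open>\<infinity>\<close>; otherwise the
  default \<open>D\<close> is used.\<close>

definition normalised :: "'a measure \<Rightarrow> 'a measure \<Rightarrow> 'a measure" where
  "normalised D m =
     (if 0 < emeasure m (space m) \<and> emeasure m (space m) < \<infinity>
      then scale_measure (inverse (emeasure m (space m))) m else D)"

text \<open>The measure \<open>p s * \<delta>\<^sub>s + \<integral> \<delta>\<^bsub>h (s, u)\<^esub> * p (h (s, u)) * f (s, u) \<nu>(du)\<close> on the measurable
  space \<open>N\<close>; here \<open>return N x\<close> is the point mass at \<open>x\<close>. The set function is countably additive, so that
  \<open>measure_of\<close> does not collapse to the null measure, as soon as the sections of \<open>h\<close>, \<open>p\<close> and \<open>f\<close> are
  measurable.\<close>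

definition unnormalised_kernel ::
  "'a measure \<Rightarrow> 'u measure \<Rightarrow> ('a \<times> 'u \<Rightarrow> 'a) \<Rightarrow> ('a \<Rightarrow> ennreal) \<Rightarrow> ('a \<times> 'u \<Rightarrow> real) \<Rightarrow> 'a \<Rightarrow> 'a measure"
where
  "unnormalised_kernel N \<nu> h p f s =
     measure_of (space N) (sets N)
       (\<lambda>A. p s * emeasure (return N s) A
          + (\<integral>\<^sup>+ u. emeasure (return N (h (s, u))) A * p (h (s, u)) * ennreal (f (s, u)) \<partial>\<nu>))"

end

theory Submission
  imports Defs
begin

text \<open>Substituting \<open>x = h (s, u)\<close> in the part of \<open>\<pi>(A \<inter> g\<^sup>-\<^sup>1(B))\<close> that lives on the second
  component and applying Tonelli's theorem shows \<open>\<pi>(A \<inter> g\<^sup>-\<^sup>1(B)) = \<integral>\<^sub>B R s A \<lambda>(ds)\<close>. For the full space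
  \<open>A\<close> this says that \<open>g(X)\<close> has density \<open>m s = R s (space N)\<close> with respect to \<open>\<lambda>\<close>. Hence
  \<open>0 < m < \<infinity>\<close> almost surely, and \<open>m\<close> cancels when \<open>R s A / m s\<close> is integrated against the law of
  \<open>g(X)\<close>.\<close>

section \<open>The mixture space and integration over it\<close>

lemma space_mixture_measure: "space (mixture_measure M M') = space M \<union> space M'"
  unfolding mixture_measure_def
  by (rule space_measure_of) (auto dest: sets.sets_into_space)

lemma sets_mixture_algebra: "sets (mixture_algebra M M') = sets (mixture_measure M M')"
proof -
  have "sets M \<union> sets M' \<subseteq> Pow (space M \<union> space M')"
    by (auto dest: sets.sets_into_space)
  then show ?thesis
    unfolding mixture_algebra_def mixture_measure_def by simp
qed

lemma sets_mixture_measureI: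
  assumes "A \<in> sets M \<or> A \<in> sets M'"
  shows "A \<in> sets (mixture_measure M M')"
proof -
  have "sets M \<union> sets M' \<subseteq> Pow (space M \<union> space M')"
    by (auto dest: sets.sets_into_space)
  then show ?thesis
    unfolding mixture_measure_def using assms by auto
qed

lemma mixture_measure_commute: "mixture_measure M M' = mixture_measure M' M"
  unfolding mixture_measure_def mixture_algebra_def
  by (simp add: Un_commute add.commute)

text \<open>By disjointness a generator from \<open>sets M'\<close> has empty trace on
  \<open>space M\<close>, so only the generators from \<open>sets M\<close> matter, and those are
  measurable already.\<close>

lemma measurable_ident_mixture_measure:
  assumes "space M \<inter> space M' = {}"
  shows "(\<lambda>x. x) \<in> M \<rightarrow>\<^sub>M mixture_measure M M'"
  unfolding mixture_measure_def
proof (rule measurable_measure_of)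
  show "sets M \<union> sets M' \<subseteq> Pow (space M \<union> space M')"
    by (auto dest: sets.sets_into_space)
  show "(\<lambda>x. x) \<in> space M \<rightarrow> space M \<union> space M'"
    by auto
  fix A assume A: "A \<in> sets M \<union> sets M'"
  show "(\<lambda>x. x) -` A \<inter> space M \<in> sets M"
  proof (cases "A \<in> sets M")
    case False
    then have "(\<lambda>x. x) -` A \<inter> space M = {}"
      using A assms by (auto dest: sets.sets_into_space)
    then show ?thesis by simp
  qed auto
qed

lemma measurable_ident_mixture_measure':
  assumes "space M \<inter> space M' = {}"
  shows "(\<lambda>x. x) \<in> M' \<rightarrow>\<^sub>M mixture_measure M M'"
  using measurable_ident_mixture_measure[of M' M] assms
  by (simp add: mixture_measure_commute Int_commute)

text \<open>Each \<open>distr\<close> is a measure, so their sum is countably additive and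
  \<open>measure_of\<close> keeps it instead of collapsing to the null measure.\<close>

lemma emeasure_mixture_measure:
  assumes "A \<in> sets (mixture_measure M M')"
  shows "emeasure (mixture_measure M M') A =
    emeasure (distr M (mixture_measure M M') (\<lambda>x. x)) A
    + emeasure (distr M' (mixture_measure M M') (\<lambda>x. x)) A"
proof -
  let ?N = "mixture_measure M M'"
  let ?D = "distr M ?N (\<lambda>x. x)" and ?D' = "distr M' ?N (\<lambda>x. x)"
  \<comment> \<open>Only the sigma-algebra of the target enters \<open>distr\<close>, so the image
    measures may be taken on the mixture space itself.\<close>
  have D: "distr M (mixture_algebra M M') (\<lambda>x. x) = ?D"
    "distr M' (mixture_algebra M M') (\<lambda>x. x) = ?D'"
    by (auto intro!: distr_cong sets_mixture_algebra)
  show ?thesis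
  proof (rule emeasure_measure_of)
    show "?N = measure_of (space M \<union> space M') (sets M \<union> sets M')
        (\<lambda>A. emeasure ?D A + emeasure ?D' A)"
      unfolding D[symmetric] by (rule mixture_measure_def)
    show "sets M \<union> sets M' \<subseteq> Pow (space M \<union> space M')"
      by (auto dest: sets.sets_into_space)
    show "positive (sets ?N) (\<lambda>A. emeasure ?D A + emeasure ?D' A)"
      by (simp add: positive_def)
    show "countably_additive (sets ?N) (\<lambda>A. emeasure ?D A + emeasure ?D' A)"
      by (auto simp: countably_additive_def suminf_add[symmetric] suminf_emeasure)
  qed fact
qed

text \<open>Additivity passes from indicators to all nonnegative measurable functions by induction
  over their construction: sums, multiples and monotone limits.\<close>

lemma nn_integral_sum_measures:
  assumes sets: "sets A = sets N" "sets B = sets N"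
    and emeasure: "\<And>C. C \<in> sets N \<Longrightarrow> emeasure N C = emeasure A C + emeasure B C"
    and "\<phi> \<in> borel_measurable N"
  shows "(\<integral>\<^sup>+ x. \<phi> x \<partial>N) = (\<integral>\<^sup>+ x. \<phi> x \<partial>A) + (\<integral>\<^sup>+ x. \<phi> x \<partial>B)"
proof -
  note [measurable_cong] = sets
  have space: "space A = space N" "space B = space N"
    using sets by (auto dest: sets_eq_imp_space_eq)
  show ?thesis
    using assms(4)
  proof (induction rule: borel_measurable_induct)
    case (cong \<phi> \<psi>)
    moreover have "(\<integral>\<^sup>+ x. \<phi> x \<partial>N) = (\<integral>\<^sup>+ x. \<psi> x \<partial>N)"
      "(\<integral>\<^sup>+ x. \<phi> x \<partial>A) = (\<integral>\<^sup>+ x. \<psi> x \<partial>A)" "(\<integral>\<^sup>+ x. \<phi> x \<partial>B) = (\<integral>\<^sup>+ x. \<psi> x \<partial>B)"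
      using cong(3) by (auto intro!: nn_integral_cong simp: space)
    ultimately show ?case by simp
  next
    case (set C)
    then show ?case by (simp add: sets emeasure)
  next
    case (mult \<phi> c)
    then show ?case
      by (simp add: nn_integral_cmult distrib_left)
  next
    case (add \<phi> \<psi>)
    then show ?case by (simp add: nn_integral_add ac_simps)
  next
    case (seq U)
    have U: "U i \<in> borel_measurable A" "U i \<in> borel_measurable B" for i
      using seq(1) by auto
    have inc: "incseq (\<lambda>i. \<integral>\<^sup>+ x. U i x \<partial>L)" for L
      using seq(3) by (auto simp: incseq_def le_fun_def intro!: nn_integral_mono)
    have SUP: "(\<integral>\<^sup>+ x. (SUP i. U i) x \<partial>L) = (SUP i. \<integral>\<^sup>+ x. U i x \<partial>L)"
      if "\<And>i. U i \<in> borel_measurable L" for L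
      unfolding SUP_apply using seq(3) that by (rule nn_integral_monotone_convergence_SUP)
    have "(\<integral>\<^sup>+ x. (SUP i. U i) x \<partial>N) = (SUP i. \<integral>\<^sup>+ x. U i x \<partial>N)"
      by (rule SUP) (rule seq(1))
    also have "\<dots> = (SUP i. (\<integral>\<^sup>+ x. U i x \<partial>A) + (\<integral>\<^sup>+ x. U i x \<partial>B))"
      using seq(5) by simp
    \<comment> \<open>A supremum splits over a sum because both sequences of integrals
      increase.\<close>
    also have "\<dots> = (SUP i. \<integral>\<^sup>+ x. U i x \<partial>A) + (SUP i. \<integral>\<^sup>+ x. U i x \<partial>B)"
      by (rule ennreal_SUP_add) (rule inc)+
    also have "\<dots> = (\<integral>\<^sup>+ x. (SUP i. U i) x \<partial>A) + (\<integral>\<^sup>+ x. (SUP i. U i) x \<partial>B)"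
      using SUP U by simp
    finally show ?case .
  qed
qed

lemma nn_integral_mixture_measure:
  assumes "space M \<inter> space M' = {}"
    and "\<phi> \<in> borel_measurable (mixture_measure M M')"
  shows "(\<integral>\<^sup>+ x. \<phi> x \<partial>mixture_measure M M') = (\<integral>\<^sup>+ x. \<phi> x \<partial>M) + (\<integral>\<^sup>+ x. \<phi> x \<partial>M')"
proof -
  let ?N = "mixture_measure M M'"
  have "(\<integral>\<^sup>+ x. \<phi> x \<partial>?N) =
    (\<integral>\<^sup>+ x. \<phi> x \<partial>distr M ?N (\<lambda>x. x)) + (\<integral>\<^sup>+ x. \<phi> x \<partial>distr M' ?N (\<lambda>x. x))"
    by (rule nn_integral_sum_measures) (simp_all add: emeasure_mixture_measure assms(2))
  with assms show ?thesis
    by (simp add: nn_integral_distr measurable_ident_mixture_measure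
        measurable_ident_mixture_measure')
qed

section \<open>The unnormalised kernel as a measure\<close>

lemma sets_unnormalised_kernel [measurable_cong]: "sets (unnormalised_kernel N \<nu> h p f s) = sets N"
  unfolding unnormalised_kernel_def by simp

lemma space_unnormalised_kernel [simp]: "space (unnormalised_kernel N \<nu> h p f s) = space N"
  unfolding unnormalised_kernel_def by (simp add: space_measure_of sets.space_closed)

text \<open>Measurability of the sections in \<open>u\<close> lets a countable sum be exchanged with
  the integral over \<open>\<nu>\<close>. Hence the defining set function is countably additive, and
  evaluating the point masses turns them into indicators.\<close>

lemma emeasure_unnormalised_kernel:
  fixes N :: "'a measure"
  assumes h [measurable]: "(\<lambda>u. h (s, u)) \<in> \<nu> \<rightarrow>\<^sub>M N"
    and p [measurable]: "p \<in> borel_measurable N"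
    and f [measurable]: "(\<lambda>u. f (s, u)) \<in> borel_measurable \<nu>"
    and A: "A \<in> sets N"
  shows "emeasure (unnormalised_kernel N \<nu> h p f s) A =
    p s * indicator A s + (\<integral>\<^sup>+ u. indicator A (h (s, u)) * p (h (s, u)) * ennreal (f (s, u)) \<partial>\<nu>)"
proof -
  let ?\<mu> = "\<lambda>A. p s * emeasure (return N s) A
    + (\<integral>\<^sup>+ u. emeasure (return N (h (s, u))) A * p (h (s, u)) * ennreal (f (s, u)) \<partial>\<nu>)"
  have "emeasure (unnormalised_kernel N \<nu> h p f s) A = ?\<mu> A"
  proof (rule emeasure_measure_of)
    show "positive (sets (unnormalised_kernel N \<nu> h p f s)) ?\<mu>"
      by (simp add: positive_def)
    show "countably_additive (sets (unnormalised_kernel N \<nu> h p f s)) ?\<mu>"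
      unfolding countably_additive_def sets_unnormalised_kernel
    proof (intro allI impI)
      fix C :: "nat \<Rightarrow> 'a set"
      assume "range C \<subseteq> sets N" and disj: "disjoint_family C"
      then have C [measurable]: "C i \<in> sets N" for i by auto
      have sum: "(\<Sum>i. emeasure (return N x) (C i)) = emeasure (return N x) (\<Union>i. C i)" for x
        using disj by (intro suminf_emeasure) auto
      have "(\<lambda>u. emeasure (return N (h (s, u))) (C i)) \<in> borel_measurable \<nu>" for i
        by (simp add: emeasure_return)
      then have "(\<Sum>i. \<integral>\<^sup>+ u. emeasure (return N (h (s, u))) (C i) * p (h (s, u))
            * ennreal (f (s, u)) \<partial>\<nu>) =
          (\<integral>\<^sup>+ u. emeasure (return N (h (s, u))) (\<Union>i. C i) * p (h (s, u)) * ennreal (f (s, u)) \<partial>\<nu>)"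
        by (subst nn_integral_suminf[symmetric])
          (simp_all only: ennreal_suminf_multc sum, measurable)
      then show "(\<Sum>i. ?\<mu> (C i)) = ?\<mu> (\<Union>i. C i)"
        by (simp add: suminf_add[symmetric] suminf_indicator disj)
    qed
  qed (auto simp: unnormalised_kernel_def A dest: sets.sets_into_space)
  with A show ?thesis by (simp add: emeasure_return)
qed

section \<open>Normalisation and disintegration of a joint law\<close>

lemma measurable_normalised:
  assumes D: "D \<in> space (prob_algebra N)"
    and sets: "\<And>s. sets (R s) = sets N"
    and R [measurable]: "\<And>A. A \<in> sets N \<Longrightarrow> (\<lambda>s. emeasure (R s) A) \<in> borel_measurable M"
  shows "(\<lambda>s. normalised D (R s)) \<in> M \<rightarrow>\<^sub>M prob_algebra N"
proof (rule measurable_prob_algebraI)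
  have space: "space (R s) = space N" for s
    using sets by (rule sets_eq_imp_space_eq)
  have D': "prob_space D" "sets D = sets N"
    using D by (auto simp: space_prob_algebra)
  \<comment> \<open>Membership in \<open>prob_algebra\<close> is required at every \<open>s\<close>,
    not just almost every one; where the mass of \<open>R s\<close> is 0 or infinite, the default
    \<open>D\<close> supplies a probability measure.\<close>
  have prob: "prob_space (normalised D (R s))" for s
  proof (cases "0 < emeasure (R s) (space (R s)) \<and> emeasure (R s) (space (R s)) < \<infinity>")
    case True
    then show ?thesis
      by (intro prob_spaceI)
        (simp add: normalised_def space_scale_measure zero_less_iff_neq_zero
          ennreal_divide_self divide_ennreal_def[symmetric] mult.commute[of "inverse _"])
  next
    case False
    show ?thesis
      unfolding normalised_def if_not_P[OF False] by (rule D')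
  qed
  show "prob_space (normalised D (R s))" for s
    by (rule prob)
  have sets_normalised: "sets (normalised D (R s)) = sets N" for s
    by (simp add: normalised_def D' sets)
  show "(\<lambda>s. normalised D (R s)) \<in> M \<rightarrow>\<^sub>M subprob_algebra N"
  proof (rule measurable_subprob_algebra)
    show "subprob_space (normalised D (R s))" for s
      by (intro prob_space_imp_subprob_space prob)
    fix A assume [measurable]: "A \<in> sets N"
    \<comment> \<open>The switch to \<open>D\<close> depends on \<open>s\<close> only through the
      total mass, which is itself measurable, so both cases join measurably.\<close>
    have "(\<lambda>s. emeasure (normalised D (R s)) A) =
        (\<lambda>s. if 0 < emeasure (R s) (space N) \<and> emeasure (R s) (space N) < \<infinity>
          then inverse (emeasure (R s) (space N)) * emeasure (R s) A else emeasure D A)"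
      by (auto simp: normalised_def space)
    also have "\<dots> \<in> borel_measurable M"
      by measurable
    finally show "(\<lambda>s. emeasure (normalised D (R s)) A) \<in> borel_measurable M" .
  qed (rule sets_normalised)
qed

text \<open>This part is independent of the mixture structure: whenever the joint law of
  \<open>X\<close> and \<open>Y\<close> disintegrates as \<open>R s\<close> integrated against
  \<open>L\<close>, normalising \<open>R s\<close> gives the conditional distribution, even if
  \<open>L\<close> is not the law of \<open>Y\<close>.\<close>

lemma cond_distribution_normalised:
  assumes prob: "prob_space \<Omega>"
    and X [measurable]: "X \<in> \<Omega> \<rightarrow>\<^sub>M N" and Y [measurable]: "Y \<in> \<Omega> \<rightarrow>\<^sub>M L"
    and sets: "\<And>s. sets (R s) = sets N"
    and R [measurable]: "\<And>A. A \<in> sets N \<Longrightarrow> (\<lambda>s. emeasure (R s) A) \<in> borel_measurable L"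
    and joint: "\<And>A B. A \<in> sets N \<Longrightarrow> B \<in> sets L \<Longrightarrow>
      emeasure \<Omega> {\<omega> \<in> space \<Omega>. X \<omega> \<in> A \<and> Y \<omega> \<in> B} = (\<integral>\<^sup>+ s\<in>B. emeasure (R s) A \<partial>L)"
  shows "(AE s in distr \<Omega> L Y. 0 < emeasure (R s) (space N) \<and> emeasure (R s) (space N) < \<infinity>)
    \<and> (\<forall>D\<in>space (prob_algebra N). cond_distribution \<Omega> N X L Y (\<lambda>s. normalised D (R s)))"
proof -
  let ?m = "\<lambda>s. emeasure (R s) (space N)"
  have space: "space (R s) = space N" for s
    using sets by (rule sets_eq_imp_space_eq)
  \<comment> \<open>Taking \<open>A = space N\<close> in \<open>joint\<close> leaves no condition on
    \<open>X\<close>, so the total mass is the density of the law of \<open>Y\<close>.\<close>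
  have law: "distr \<Omega> L Y = density L ?m"
  proof (rule measure_eqI)
    fix B assume "B \<in> sets (distr \<Omega> L Y)"
    then have B [measurable]: "B \<in> sets L" by simp
    have "emeasure (distr \<Omega> L Y) B = emeasure \<Omega> {\<omega> \<in> space \<Omega>. X \<omega> \<in> space N \<and> Y \<omega> \<in> B}"
      using measurable_space[OF X] by (auto simp: emeasure_distr intro!: arg_cong[where f="emeasure \<Omega>"])
    then show "emeasure (distr \<Omega> L Y) B = emeasure (density L ?m) B"
      by (simp add: joint emeasure_density)
  qed simp
  \<comment> \<open>The density of a probability measure has integral 1, hence is finite almost
    everywhere for \<open>L\<close>.\<close>
  have "(\<integral>\<^sup>+ s. ?m s \<partial>L) = emeasure (density L ?m) (space L)"
    by (simp add: emeasure_density nn_integral_set_ennreal[symmetric] cong: nn_integral_cong)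
  also have "\<dots> = 1"
    using prob_space.emeasure_space_1[OF prob_space.prob_space_distr[OF prob Y]] law by simp
  finally have finite: "AE s in L. ?m s < \<infinity>"
    using nn_integral_PInf_AE[of ?m L] by (auto simp: less_top)
  \<comment> \<open>Points of zero mass need not be null for \<open>L\<close>, but they are null for
    the law of \<open>Y\<close>, whose density vanishes there.\<close>
  then have positive: "AE s in distr \<Omega> L Y. 0 < ?m s \<and> ?m s < \<infinity>"
    unfolding law by (subst AE_density) auto
  have "cond_distribution \<Omega> N X L Y (\<lambda>s. normalised D (R s))"
    if D: "D \<in> space (prob_algebra N)" for D
  proof -
    have K [measurable]: "(\<lambda>s. normalised D (R s)) \<in> L \<rightarrow>\<^sub>M prob_algebra N"
      by (rule measurable_normalised[OF D sets R])
    show ?thesis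
      unfolding cond_distribution_def
    proof (intro conjI ballI X Y K)
      fix A B assume A [measurable]: "A \<in> sets N" and B [measurable]: "B \<in> sets L"
      have [measurable]: "(\<lambda>s. emeasure (normalised D (R s)) A) \<in> borel_measurable L"
        using measurable_compose[OF measurable_prob_algebraD[OF K] measurable_emeasure_subprob_algebra[OF A]] .
      \<comment> \<open>At mass 0 the normalised measure is the arbitrary \<open>D\<close>, yet both
        sides vanish because \<open>R s A\<close> is at most the total mass. At positive finite mass
        the factor cancels its inverse.\<close>
      have cancel: "?m s * emeasure (normalised D (R s)) A = emeasure (R s) A" if "?m s < \<infinity>" for s
      proof (cases "?m s = 0")
        case True
        moreover have "emeasure (R s) A \<le> ?m s"
          using emeasure_space[of "R s" A] by (simp add: space)
        ultimately show ?thesis by simp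
      next
        case False
        with that have "?m s * inverse (?m s) = 1"
          by (simp add: ennreal_divide_self divide_ennreal_def[symmetric])
        with False that show ?thesis
          by (simp add: normalised_def space mult.assoc[symmetric] zero_less_iff_neq_zero)
      qed
      have "(\<integral>\<^sup>+ s\<in>B. emeasure (normalised D (R s)) A \<partial>distr \<Omega> L Y) =
          (\<integral>\<^sup>+ s. ?m s * (emeasure (normalised D (R s)) A * indicator B s) \<partial>L)"
        unfolding law by (rule nn_integral_density) measurable
      \<comment> \<open>The integral is now against \<open>L\<close>, so cancellation has to hold
        almost everywhere for \<open>L\<close>; this is why finiteness was established there and not
        just under the law of \<open>Y\<close>.\<close>
      also have "\<dots> = (\<integral>\<^sup>+ s\<in>B. emeasure (R s) A \<partial>L)"
        by (rule nn_integral_cong_AE) (use finite in \<open>auto simp: cancel mult.assoc[symmetric]\<close>)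
      finally show "(\<integral>\<^sup>+ s\<in>B. emeasure (normalised D (R s)) A \<partial>distr \<Omega> L Y) =
          emeasure \<Omega> {\<omega> \<in> space \<Omega>. X \<omega> \<in> A \<and> Y \<omega> \<in> B}"
        by (simp add: joint)
    qed
  qed
  with positive show ?thesis by blast
qed

section \<open>Change of variables and the joint law on the mixture space\<close>

lemma nn_integral_change_variables:
  assumes k [measurable]: "k \<in> M' \<rightarrow>\<^sub>M L" and h [measurable]: "h \<in> L \<rightarrow>\<^sub>M M'"
    and inverse: "\<And>x. x \<in> space M' \<Longrightarrow> h (k x) = x"
    and f [measurable]: "f \<in> borel_measurable L"
    and image: "\<And>C. C \<in> sets L \<Longrightarrow> emeasure M' (k -` C \<inter> space M') = (\<integral>\<^sup>+ z\<in>C. f z \<partial>L)"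
    and \<phi> [measurable]: "\<phi> \<in> borel_measurable M'"
  shows "(\<integral>\<^sup>+ x. \<phi> x \<partial>M') = (\<integral>\<^sup>+ z. \<phi> (h z) * f z \<partial>L)"
proof -
  \<comment> \<open>The assumption \<open>image\<close> identifies the image measure under
    \<open>k\<close>. Writing \<open>\<phi>\<close> as \<open>\<phi>\<close> after \<open>h\<close>
    after \<open>k\<close> then reduces the claim to integrating \<open>\<phi>\<close> after
    \<open>h\<close> against that image.\<close>
  have distr: "distr M' L k = density L f"
    by (rule measure_eqI) (simp_all add: emeasure_distr emeasure_density image)
  have "(\<integral>\<^sup>+ x. \<phi> x \<partial>M') = (\<integral>\<^sup>+ x. \<phi> (h (k x)) \<partial>M')"
    by (rule nn_integral_cong) (simp add: inverse)
  also have "\<dots> = (\<integral>\<^sup>+ z. \<phi> (h z) \<partial>distr M' L k)"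
    by (simp add: nn_integral_distr)
  also have "\<dots> = (\<integral>\<^sup>+ z. \<phi> (h z) * f z \<partial>L)"
    unfolding distr by (simp add: nn_integral_density mult.commute)
  finally show ?thesis .
qed

text \<open>Sigma-finiteness of \<open>\<nu>\<close> makes the inner integral over \<open>u\<close>
  a measurable function of \<open>s\<close>.\<close>

lemma borel_measurable_emeasure_unnormalised_kernel:
  fixes N :: "'a measure"
  assumes \<nu>: "sigma_finite_measure \<nu>"
    and id [measurable]: "(\<lambda>x. x) \<in> M \<rightarrow>\<^sub>M N"
    and h [measurable]: "h \<in> M \<Otimes>\<^sub>M \<nu> \<rightarrow>\<^sub>M N"
    and p [measurable]: "p \<in> borel_measurable N"
    and f [measurable]: "f \<in> borel_measurable (M \<Otimes>\<^sub>M \<nu>)"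
    and A [measurable]: "A \<in> sets N"
  shows "(\<lambda>s. emeasure (unnormalised_kernel N \<nu> h p f s) A) \<in> borel_measurable M"
proof -
  interpret \<nu>: sigma_finite_measure \<nu> by (rule \<nu>)
  have [measurable]: "p \<in> borel_measurable M" "indicator A \<in> borel_measurable M"
    using measurable_compose[OF id p] measurable_compose[OF id borel_measurable_indicator[OF A]]
    by simp_all
  have "(\<lambda>s. p s * indicator A s
      + (\<integral>\<^sup>+ u. indicator A (h (s, u)) * p (h (s, u)) * ennreal (f (s, u)) \<partial>\<nu>)) \<in> borel_measurable M"
    by measurable
  \<comment> \<open>The closed formula is needed only for \<open>s\<close> in
    \<open>space M\<close>, where the sections of \<open>h\<close> and \<open>f\<close> are
    measurable.\<close>
  then show ?thesis
    by (rule measurable_cong[THEN iffD2, rotated])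
      (intro emeasure_unnormalised_kernel; measurable)
qed

text \<open>On \<open>M\<close> the map \<open>g\<close> is the identity, which produces the
  point-mass term of the kernel; on \<open>M'\<close> the substitution \<open>x = h (s, u)\<close>
  produces the integral term.\<close>

lemma emeasure_density_mixture_measure:
  fixes M M' :: "'a measure" and \<nu> :: "'u measure" and f :: "'a \<times> 'u \<Rightarrow> real"
  defines "N \<equiv> mixture_measure M M'"
  assumes \<nu>: "sigma_finite_measure \<nu>"
    and disjoint: "space M \<inter> space M' = {}"
    and p [measurable]: "p \<in> borel_measurable N"
    and g [measurable]: "g \<in> N \<rightarrow>\<^sub>M M" and g_M: "\<And>x. x \<in> space M \<Longrightarrow> g x = x"
    and k: "k \<in> M' \<rightarrow>\<^sub>M M \<Otimes>\<^sub>M \<nu>" and h [measurable]: "h \<in> M \<Otimes>\<^sub>M \<nu> \<rightarrow>\<^sub>M M'"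
    and h_k: "\<And>x. x \<in> space M' \<Longrightarrow> h (k x) = x"
    and g_h: "\<And>z. z \<in> space (M \<Otimes>\<^sub>M \<nu>) \<Longrightarrow> g (h z) = fst z"
    and f [measurable]: "f \<in> borel_measurable (M \<Otimes>\<^sub>M \<nu>)"
    and image: "\<And>C. C \<in> sets (M \<Otimes>\<^sub>M \<nu>) \<Longrightarrow>
      emeasure M' (k -` C \<inter> space M') = (\<integral>\<^sup>+ z\<in>C. ennreal (f z) \<partial>(M \<Otimes>\<^sub>M \<nu>))"
    and A [measurable]: "A \<in> sets N" and B [measurable]: "B \<in> sets M"
  shows "emeasure (density N p) (A \<inter> (g -` B \<inter> space N)) =
    (\<integral>\<^sup>+ s\<in>B. emeasure (unnormalised_kernel N \<nu> h p f s) A \<partial>M)"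
proof -
  interpret \<nu>: sigma_finite_measure \<nu> by (rule \<nu>)
  have id_M: "(\<lambda>x. x) \<in> M \<rightarrow>\<^sub>M N" and id_M': "(\<lambda>x. x) \<in> M' \<rightarrow>\<^sub>M N"
    using disjoint by (auto simp: N_def measurable_ident_mixture_measure measurable_ident_mixture_measure')
  have [measurable]: "p \<in> borel_measurable M" "p \<in> borel_measurable M'"
    "indicator A \<in> borel_measurable M" "indicator A \<in> borel_measurable M'"
    "g \<in> M' \<rightarrow>\<^sub>M M" "h \<in> M \<Otimes>\<^sub>M \<nu> \<rightarrow>\<^sub>M N"
    using measurable_compose[OF id_M p] measurable_compose[OF id_M' p]
      measurable_compose[OF id_M borel_measurable_indicator[OF A]]
      measurable_compose[OF id_M' borel_measurable_indicator[OF A]]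
      measurable_compose[OF id_M' g] measurable_compose[OF h id_M']
    by simp_all
  let ?\<phi> = "\<lambda>x. p x * (indicator A x * indicator B (g x)) :: ennreal"
  let ?q = "\<lambda>z. indicator A (h z) * p (h z) * ennreal (f z)"
  have "emeasure (density N p) (A \<inter> (g -` B \<inter> space N)) =
      (\<integral>\<^sup>+ x. p x * indicator (A \<inter> (g -` B \<inter> space N)) x \<partial>N)"
    by (rule emeasure_density) measurable
  also have "\<dots> = (\<integral>\<^sup>+ x. ?\<phi> x \<partial>N)"
    by (rule nn_integral_cong) (simp add: indicator_def)
  also have "\<dots> = (\<integral>\<^sup>+ x. ?\<phi> x \<partial>M) + (\<integral>\<^sup>+ x. ?\<phi> x \<partial>M')"
    unfolding N_def by (rule nn_integral_mixture_measure[OF disjoint]) (simp flip: N_def)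
  also have "(\<integral>\<^sup>+ x. ?\<phi> x \<partial>M) = (\<integral>\<^sup>+ s. p s * indicator A s * indicator B s \<partial>M)"
    by (rule nn_integral_cong) (simp add: g_M mult.assoc)
  also have "(\<integral>\<^sup>+ x. ?\<phi> x \<partial>M') = (\<integral>\<^sup>+ z. ?\<phi> (h z) * ennreal (f z) \<partial>(M \<Otimes>\<^sub>M \<nu>))"
    by (rule nn_integral_change_variables[OF k h h_k]) (simp_all add: image)
  \<comment> \<open>Since \<open>g (h (s, u)) = s\<close>, the condition on \<open>g\<close>
    involves \<open>s\<close> alone; after Tonelli it can be pulled out of the integral over
    \<open>u\<close>.\<close>
  also have "\<dots> = (\<integral>\<^sup>+ z. ?q z * indicator B (fst z) \<partial>(M \<Otimes>\<^sub>M \<nu>))"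
    by (rule nn_integral_cong) (simp add: g_h ac_simps)
  also have "\<dots> = (\<integral>\<^sup>+ s. (\<integral>\<^sup>+ u. ?q (s, u) * indicator B s \<partial>\<nu>) \<partial>M)"
    by (subst \<nu>.nn_integral_fst[symmetric]) simp_all
  also have "\<dots> = (\<integral>\<^sup>+ s. (\<integral>\<^sup>+ u. ?q (s, u) \<partial>\<nu>) * indicator B s \<partial>M)"
    by (intro nn_integral_cong nn_integral_multc) measurable
  also have "(\<integral>\<^sup>+ s. p s * indicator A s * indicator B s \<partial>M) + \<dots> =
      (\<integral>\<^sup>+ s. p s * indicator A s * indicator B s + (\<integral>\<^sup>+ u. ?q (s, u) \<partial>\<nu>) * indicator B s \<partial>M)"
    by (rule nn_integral_add[symmetric]) measurable
  also have "\<dots> = (\<integral>\<^sup>+ s\<in>B. emeasure (unnormalised_kernel N \<nu> h p f s) A \<partial>M)"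
  proof (rule nn_integral_cong)
    fix s assume [measurable]: "s \<in> space M"
    have "emeasure (unnormalised_kernel N \<nu> h p f s) A =
        p s * indicator A s + (\<integral>\<^sup>+ u. ?q (s, u) \<partial>\<nu>)"
      by (intro emeasure_unnormalised_kernel) measurable
    then show "p s * indicator A s * indicator B s + (\<integral>\<^sup>+ u. ?q (s, u) \<partial>\<nu>) * indicator B s =
        emeasure (unnormalised_kernel N \<nu> h p f s) A * indicator B s"
      by (simp add: distrib_right)
  qed
  finally show ?thesis .
qed

section \<open>Measurability of \<open>g\<close> and the conclusion\<close>

lemma measurable_mixture_measure:
  assumes disjoint: "space M \<inter> space M' = {}"
    and g: "\<And>x. x \<in> space M \<Longrightarrow> g x = x" "\<And>x. x \<in> space M' \<Longrightarrow> g x = t x"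
    and t: "t \<in> M' \<rightarrow>\<^sub>M M"
  shows "g \<in> mixture_measure M M' \<rightarrow>\<^sub>M M"
proof (rule measurableI)
  show "g x \<in> space M" if "x \<in> space (mixture_measure M M')" for x
    using that g measurable_space[OF t] by (auto simp: space_mixture_measure)
  fix B assume B: "B \<in> sets M"
  \<comment> \<open>The preimage splits along the two components into one generator from
    each.\<close>
  have "g -` B \<inter> space (mixture_measure M M') = B \<union> (t -` B \<inter> space M')"
    using g disjoint sets.sets_into_space[OF B] by (auto simp: space_mixture_measure)
  also have "\<dots> \<in> sets (mixture_measure M M')"
    using B measurable_sets[OF t B] by (intro sets.Un sets_mixture_measureI) auto
  finally show "g -` B \<inter> space (mixture_measure M M') \<in> sets (mixture_measure M M')" .
qed

theorem lemma5:
  fixes M M' N P :: "'a measure" and \<nu> :: "'u measure" and \<Omega> :: "'w measure"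
    and X :: "'w \<Rightarrow> 'a" and p :: "'a \<Rightarrow> ennreal"
    and sf g :: "'a \<Rightarrow> 'a" and uf :: "'a \<Rightarrow> 'u"
    and f :: "'a \<times> 'u \<Rightarrow> real" and h :: "'a \<times> 'u \<Rightarrow> 'a"
    and R :: "'a \<Rightarrow> 'a measure"
  assumes sigma_finite: "sigma_finite_measure M" "sigma_finite_measure M'"
    and disjoint: "space M \<inter> space M' = {}"
    and N: "N = mixture_measure M M'"
    and p: "p \<in> borel_measurable N"
    and P: "P = density N p" "prob_space P"
    and X: "prob_space \<Omega>" "X \<in> \<Omega> \<rightarrow>\<^sub>M N" "distr \<Omega> N X = P"
    and sf: "sf \<in> M' \<rightarrow>\<^sub>M M"
    and g: "\<And>x. x \<in> space M' \<Longrightarrow> g x = sf x" "\<And>x. x \<in> space M \<Longrightarrow> g x = x"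
    and nu: "sigma_finite_measure \<nu>"
    and uf: "uf \<in> M' \<rightarrow>\<^sub>M \<nu>"
    and f: "f \<in> borel_measurable (M \<Otimes>\<^sub>M \<nu>)" "\<And>z. z \<in> space (M \<Otimes>\<^sub>M \<nu>) \<Longrightarrow> 0 \<le> f z"
    and bij: "bij_betw (\<lambda>x. (sf x, uf x)) (space M') (space M \<times> space \<nu>)"
    and h: "h = the_inv_into (space M') (\<lambda>x. (sf x, uf x))"
    and h_measurable: "h \<in> M \<Otimes>\<^sub>M \<nu> \<rightarrow>\<^sub>M M'"
    and image: "\<And>C. C \<in> sets (M \<Otimes>\<^sub>M \<nu>) \<Longrightarrow>
      emeasure M' ((\<lambda>x. (sf x, uf x)) -` C \<inter> space M') = (\<integral>\<^sup>+ z\<in>C. ennreal (f z) \<partial>(M \<Otimes>\<^sub>M \<nu>))"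
    and R: "R = unnormalised_kernel N \<nu> h p f"
  shows "(AE s in distr \<Omega> M (g \<circ> X). 0 < emeasure (R s) (space N) \<and> emeasure (R s) (space N) < \<infinity>)
    \<and> (\<forall>D\<in>space (prob_algebra N). cond_distribution \<Omega> N X M (g \<circ> X) (\<lambda>s. normalised D (R s)))"
proof -
  let ?k = "\<lambda>x. (sf x, uf x)"
  have id_M: "(\<lambda>x. x) \<in> M \<rightarrow>\<^sub>M N" and id_M': "(\<lambda>x. x) \<in> M' \<rightarrow>\<^sub>M N"
    using disjoint by (auto simp: N measurable_ident_mixture_measure measurable_ident_mixture_measure')
  have h_N: "h \<in> M \<Otimes>\<^sub>M \<nu> \<rightarrow>\<^sub>M N"
    using measurable_compose[OF h_measurable id_M'] by simp
  have g_N: "g \<in> N \<rightarrow>\<^sub>M M"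
    unfolding N by (rule measurable_mixture_measure[OF disjoint g(2) g(1) sf])
  have k: "?k \<in> M' \<rightarrow>\<^sub>M M \<Otimes>\<^sub>M \<nu>"
    using sf uf by measurable
  have h_k: "h (?k x) = x" if "x \<in> space M'" for x
    unfolding h using the_inv_into_f_f[OF bij_betw_imp_inj_on[OF bij] that] .
  \<comment> \<open>Surjectivity makes \<open>h\<close> a right inverse of \<open>?k\<close> as
    well; its values lie in \<open>space M'\<close>, where \<open>g\<close> is \<open>sf\<close>,
    the first coordinate of \<open>?k\<close>.\<close>
  have g_h: "g (h z) = fst z" if "z \<in> space (M \<Otimes>\<^sub>M \<nu>)" for z
  proof -
    have "?k (h z) = z"
      unfolding h using f_the_inv_into_f_bij_betw[OF bij, of z] that
      by (simp add: space_pair_measure)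
    then have "sf (h z) = fst z"
      by (auto simp: prod_eq_iff)
    with measurable_space[OF h_measurable that] show ?thesis
      by (simp add: g)
  qed
  have Y: "g \<circ> X \<in> \<Omega> \<rightarrow>\<^sub>M M"
    using X(2) g_N by (rule measurable_comp)
  have sets_R: "sets (R s) = sets N" for s
    by (simp add: R sets_unnormalised_kernel)
  have R_measurable: "(\<lambda>s. emeasure (R s) A) \<in> borel_measurable M" if "A \<in> sets N" for A
    unfolding R by (rule borel_measurable_emeasure_unnormalised_kernel[OF nu id_M h_N p f(1) that])
  have joint: "emeasure \<Omega> {\<omega> \<in> space \<Omega>. X \<omega> \<in> A \<and> (g \<circ> X) \<omega> \<in> B} = (\<integral>\<^sup>+ s\<in>B. emeasure (R s) A \<partial>M)"
    if A: "A \<in> sets N" and B: "B \<in> sets M" for A B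
  proof -
    \<comment> \<open>The event depends on \<open>\<omega>\<close> only through \<open>X\<close>, so
      its probability is the \<open>P\<close>-measure of a subset of the mixture space.\<close>
    have "{\<omega> \<in> space \<Omega>. X \<omega> \<in> A \<and> (g \<circ> X) \<omega> \<in> B} = X -` (A \<inter> (g -` B \<inter> space N)) \<inter> space \<Omega>"
      using measurable_space[OF X(2)] by auto
    then have "emeasure \<Omega> {\<omega> \<in> space \<Omega>. X \<omega> \<in> A \<and> (g \<circ> X) \<omega> \<in> B} =
        emeasure (density N p) (A \<inter> (g -` B \<inter> space N))"
      using A measurable_sets[OF g_N B] X(2) by (simp flip: P(1) X(3) add: emeasure_distr)
    also have "\<dots> = (\<integral>\<^sup>+ s\<in>B. emeasure (R s) A \<partial>M)"
      unfolding R using nu disjoint p g_N g(2) k h_measurable h_k g_h f(1) image A B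
      unfolding N by (rule emeasure_density_mixture_measure)
    finally show ?thesis .
  qed
  show ?thesis
    by (rule cond_distribution_normalised[OF X(1) X(2) Y sets_R R_measurable joint])
qed

end
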